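(* For every constant specification $CS$, every set of formulas $\Gamma$ and every formula $\Phi$ of the language of $\mathit{FOLP}^\Box$: if $\Gamma \vdash_{CS} \Phi$, then $\Gamma \vDash_{CS} \Phi$, i.e. for every Fitting model $\mathcal{M}=(W,R,(D_w)_{w\in W},I,\mathcal{E})$ meeting $CS$, every valuation $\nu$ for $\mathcal{M}$ and every $w\in W$, if $(\mathcal{M},\nu),w\Vdash \Psi$ for all $\Psi\in\Gamma$ and $\nu(FV(\Phi))\subseteq D_w$, then $(\mathcal{M},\nu),w\Vdash\Phi$.
   Context: Language. Fix countably infinite sets $Var$ (individual variables), $JVar$ (justification variables), $JConst$ (justification constants), and infinitely many predicate symbols of each arity. Justification terms: $t ::= p \mid c \mid (t\cdot t)\mid (t+t)\mid\ !t \mid gen_x(t)$ with $p\in JVar$, $c\in JConst$, $x\in Var$ (the $x$ in $gen_x$ is only an index). Formulas: $P(x_1,\dots,x_n)$ ($P$ $n$-ary, $x_i\in Var$); $\neg\Phi$, $\Phi\wedge\Psi$, $\Phi\vee\Psi$, $\Phi\to\Psi$, $\Phi\leftrightarrow\Psi$, $\forall x\Phi$, $\exists x\Phi$; and, for every finite $X\subseteq Var$ and term $t$, $\Box_X\Phi$ and $t{:}_X\Phi$. Free/bound occurrences are as usual for the first-order constructs; in $\Box_X\Phi$ and $t{:}_X\Phi$ bound occurrences of $\Phi$ stay bound, a free occurrence of $x$ in $\Phi$ stays free iff $x\in X$ (otherwise it becomes bound), and the variables in $X$ are free. Thus $FV(\Box_X\Phi)=FV(t{:}_X\Phi)=X$.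 $\Phi[x/y]$ denotes substitution of $y$ for the free occurrences of $x$ (assuming no capture). Logic $\mathit{FOLP}^\Box_0$. Axioms: (A0) classical first-order axioms; (A1) $t{:}_{X\cup\{y\}}\Phi\to t{:}_X\Phi$ and (A1$'$) $\Box_{X\cup\{y\}}\Phi\to\Box_X\Phi$, for $y\notin FV(\Phi)$; (A2) $t{:}_X\Phi\to t{:}_{X\cup\{y\}}\Phi$, (A2$'$) $\Box_X\Phi\to\Box_{X\cup\{y\}}\Phi$; (A3) $t{:}_X\Phi\to\Phi$, (A3$'$) $\Box_X\Phi\to\Phi$; (A4) $t{:}_X(\Phi\to\Psi)\to(s{:}_X\Phi\to [t\cdot s]{:}_X\Psi)$, (A4$'$) $\Box_X(\Phi\to\Psi)\to(\Box_X\Phi\to\Box_X\Psi)$; (A5) $t{:}_X\Phi\to[t+s]{:}_X\Phi$ and $s{:}_X\Phi\to[t+s]{:}_X\Phi$; (A6) $t{:}_X\Phi\to\ !t{:}_X t{:}_X\Phi$, (A6$'$) $\Box_X\Phi\to\Box_X\Box_X\Phi$; (A7) $t{:}_X\Phi\to gen_x(t){:}_X\forall x\Phi$, (A7$'$) $\Box_X\Phi\to\Box_X\forall x\Phi$, for $x\notin X$; (A8) $t{:}_X\Phi\to\Box_X\Phi$. Rules: modus ponens; generalization ($\vdash\Phi\Rightarrow\vdash\forall x\Phi$); necessitation ($\vdash\Phi\Rightarrow\vdash\Box_\varnothing\Phi$). A constant specification $CS$ is a set of formulas $c{:}_\varnothing\Phi$ with $c\in JConst$ and $\Phi$ an axiom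 of $\mathit{FOLP}^\Box_0$; $\mathit{FOLP}^\Box_{CS}$ adds the members of $CS$ as axioms. $\Gamma\vdash_{CS}\Phi$ means $\Phi$ is derivable in $\mathit{FOLP}^\Box_{CS}$ from hypotheses $\Gamma$, where generalization is applied only to variables not free in $\Gamma$ and necessitation only to axioms of $\mathit{FOLP}^\Box_0$. Valuations. A valuation of an alphabet $X$ in $D$ is a function $f:X\to D$; it is finite if $X$ is finite; $\varnothing$ is the valuation of $\varnothing$. $f\upharpoonright Y$ is the restriction of $f$ to $Y\cap Dom(f)$. $ext(f,D)$ is the set of finite extensions $g\supseteq f$ with $Im(g)\subseteq D$. $f^{x_1,\dots,x_n}_{d_1,\dots,d_n}$ agrees with $f$ except that it sends $x_i$ to $d_i$. For a substitution $\sigma$ of variables and a valuation $g$, $g\circ\sigma$ is the valuation $x\mapsto g(\sigma(x))$. Fitting model: $\mathcal{M}=(W,R,(D_w)_{w\in W},I,\mathcal{E})$ where $W\neq\varnothing$, $R$ reflexive and transitive on $W$, each $D_w\neq\varnothing$, $wRu$ implies $D_w\subseteq D_u$, $D=\bigcup_w D_w$, $I(P,w)\subseteq D_w^n$ for $n$-ary $P$, and $\mathcal{E}(t,\Phi,f)\subseteq W$ for every term $t$, formula $\Phi$ and finite valuation $f$ of individual variables in $D$, satisfying: (adequacy) $w\in\mathcal{E}(t,\Phi,f)$ implies $Im(f)\subseteq D_w$; (substitution) if $x_1,\dots,x_n$ are distinct variables of $FV(\Phi)$ and $\sigma$ replaces $x_i$ by variables $y_i$, then $\mathcal{E}(t,\Phi\sigma,f\upharpoonright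 FV(\Phi\sigma))=\mathcal{E}(t,\Phi,f\circ\sigma)$; ($R$-closure) $wRu$ and $w\in\mathcal{E}(t,\Phi,f)$ imply $u\in\mathcal{E}(t,\Phi,f)$; (extension) if $w\in\mathcal{E}(t,\Phi,f)$ and $g\in ext(f,D_w)$ then $w\in\mathcal{E}(t,\Phi,g)$; (restriction) $\mathcal{E}(t,\Phi,f)\subseteq\mathcal{E}(t,\Phi,f\upharpoonright FV(\Phi))$; ($\cdot$) $\mathcal{E}(t,\Phi\to\Psi,f)\cap\mathcal{E}(s,\Phi,f)\subseteq\mathcal{E}(t\cdot s,\Psi,f)$; ($+$) $\mathcal{E}(t,\Phi,f)\cup\mathcal{E}(s,\Phi,f)\subseteq\mathcal{E}(t+s,\Phi,f)$; ($!$) if $w\in\mathcal{E}(t,\Phi,f)$ then $w\in\mathcal{E}(!t,t{:}_X\Phi,g)$ for all $g\in ext(f,D_w)$ and all $X$ with $Dom(f)\cap FV(\Phi)\subseteq X\subseteq Dom(g)$; ($gen_x$) $\mathcal{E}(t,\Phi,f)\subseteq\mathcal{E}(gen_x(t),\forall x\Phi,f)$ for $x\notin Dom(f)\cap FV(\Phi)$. $\mathcal{M}$ meets $CS$ if $c{:}_\varnothing\Phi\in CS$ implies $\mathcal{E}(c,\Phi,\varnothing)=W$. Truth. A valuation for $\mathcal{M}$ is a map $\nu:Var\to D$. $(\mathcal{M},\nu),w\Vdash P(x_1,\dots,x_n)$ iff $\langle\nu(x_1),\dots,\nu(x_n)\rangle\in I(P,w)$; $\Vdash\neg\Psi$ iff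 $\nu(FV(\Psi))\subseteq D_w$ and $\not\Vdash\Psi$; $\wedge$ as usual; $\Vdash\forall x\Psi$ iff $(\mathcal{M},\nu^x_a),w\Vdash\Psi$ for all $a\in D_w$ (other connectives and $\exists$ are the standard abbreviations); $\Vdash\Box_X\Psi$ iff $\nu(X)\subseteq D_w$ and for all $u$ with $wRu$ and all $d_1,\dots,d_n\in D_u$, $(\mathcal{M},\nu^{y_1,\dots,y_n}_{d_1,\dots,d_n}),u\Vdash\Psi$ where $\{y_1,\dots,y_n\}=FV(\Psi)\setminus X$; $\Vdash t{:}_X\Psi$ iff the two conditions for $\Box_X\Psi$ hold and $w\in\mathcal{E}(t,\Psi,\nu\upharpoonright(FV(\Psi)\cap X))$. *)

theory Defs
  imports Main "HOL-Library.FSet"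
begin

type_synonym var = nat
type_synonym jvar = nat
type_synonym jconst = nat

datatype jterm =
    JVar jvar
  | JConst jconst
  | App jterm jterm
  | Plus jterm jterm
  | Bang jterm
  | Gen var jterm

text \<open>A predicate symbol is a pair of a name and an arity; \<open>Pred p xs\<close> is the atomic formula
  built from the symbol \<open>(p, length xs)\<close>.  Index sets \<open>X\<close> of modalities are of type
  \<open>var fset\<close>, hence finite.\<close>

type_synonym psym = "nat \<times> nat"

datatype form =
    Pred nat "var list"
  | Neg form
  | Conj form form
  | Disj form form
  | Imp form form
  | Iff form form
  | Forall var form
  | Exists var form
  | Box "var fset" form
  | Just jterm "var fset" form

primrec FV :: "form \<Rightarrow> var set" where
  "FV (Pred p xs) = set xs"
| "FV (Neg \<phi>) = FV \<phi>"
| "FV (Conj \<phi> \<psi>) = FV \<phi> \<union> FV \<psi>"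
| "FV (Disj \<phi> \<psi>) = FV \<phi> \<union> FV \<psi>"
| "FV (Imp \<phi> \<psi>) = FV \<phi> \<union> FV \<psi>"
| "FV (Iff \<phi> \<psi>) = FV \<phi> \<union> FV \<psi>"
| "FV (Forall x \<phi>) = FV \<phi> - {x}"
| "FV (Exists x \<phi>) = FV \<phi> - {x}"
| "FV (Box X \<phi>) = fset X"
| "FV (Just t X \<phi>) = fset X"

text \<open>Simultaneous replacement of the free occurrences of each \<open>x\<close> by \<open>\<sigma> x\<close>.  It is used only
  together with \<open>free_for\<close>, which says that no capture occurs.  In \<open>Box X \<phi>\<close> and
  \<open>Just t X \<phi>\<close> the variables of \<open>FV \<phi> - X\<close> are bound, so none of them may be inserted into the
  index set: its bound occurrences in \<open>\<phi>\<close> would become free.\<close>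

primrec subst :: "(var \<Rightarrow> var) \<Rightarrow> form \<Rightarrow> form" where
  "subst \<sigma> (Pred p xs) = Pred p (map \<sigma> xs)"
| "subst \<sigma> (Neg \<phi>) = Neg (subst \<sigma> \<phi>)"
| "subst \<sigma> (Conj \<phi> \<psi>) = Conj (subst \<sigma> \<phi>) (subst \<sigma> \<psi>)"
| "subst \<sigma> (Disj \<phi> \<psi>) = Disj (subst \<sigma> \<phi>) (subst \<sigma> \<psi>)"
| "subst \<sigma> (Imp \<phi> \<psi>) = Imp (subst \<sigma> \<phi>) (subst \<sigma> \<psi>)"
| "subst \<sigma> (Iff \<phi> \<psi>) = Iff (subst \<sigma> \<phi>) (subst \<sigma> \<psi>)"
| "subst \<sigma> (Forall x \<phi>) = Forall x (subst (\<sigma>(x := x)) \<phi>)"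
| "subst \<sigma> (Exists x \<phi>) = Exists x (subst (\<sigma>(x := x)) \<phi>)"
| "subst \<sigma> (Box X \<phi>) = Box (\<sigma> |`| X) (subst (override_on id \<sigma> (fset X)) \<phi>)"
| "subst \<sigma> (Just t X \<phi>) = Just t (\<sigma> |`| X) (subst (override_on id \<sigma> (fset X)) \<phi>)"

primrec free_for :: "(var \<Rightarrow> var) \<Rightarrow> form \<Rightarrow> bool" where
  "free_for \<sigma> (Pred p xs) \<longleftrightarrow> True"
| "free_for \<sigma> (Neg \<phi>) \<longleftrightarrow> free_for \<sigma> \<phi>"
| "free_for \<sigma> (Conj \<phi> \<psi>) \<longleftrightarrow> free_for \<sigma> \<phi> \<and> free_for \<sigma> \<psi>"
| "free_for \<sigma> (Disj \<phi> \<psi>) \<longleftrightarrow> free_for \<sigma> \<phi> \<and> free_for \<sigma> \<psi>"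
| "free_for \<sigma> (Imp \<phi> \<psi>) \<longleftrightarrow> free_for \<sigma> \<phi> \<and> free_for \<sigma> \<psi>"
| "free_for \<sigma> (Iff \<phi> \<psi>) \<longleftrightarrow> free_for \<sigma> \<phi> \<and> free_for \<sigma> \<psi>"
| "free_for \<sigma> (Forall x \<phi>) \<longleftrightarrow> x \<notin> \<sigma> ` (FV \<phi> - {x}) \<and> free_for (\<sigma>(x := x)) \<phi>"
| "free_for \<sigma> (Exists x \<phi>) \<longleftrightarrow> x \<notin> \<sigma> ` (FV \<phi> - {x}) \<and> free_for (\<sigma>(x := x)) \<phi>"
| "free_for \<sigma> (Box X \<phi>) \<longleftrightarrow>
     \<sigma> ` fset X \<inter> (FV \<phi> - fset X) = {} \<and> free_for (override_on id \<sigma> (fset X)) \<phi>"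
| "free_for \<sigma> (Just t X \<phi>) \<longleftrightarrow>
     \<sigma> ` fset X \<inter> (FV \<phi> - fset X) = {} \<and> free_for (override_on id \<sigma> (fset X)) \<phi>"

primrec peval :: "(form \<Rightarrow> bool) \<Rightarrow> form \<Rightarrow> bool" where
  "peval v (Pred p xs) \<longleftrightarrow> v (Pred p xs)"
| "peval v (Neg \<phi>) \<longleftrightarrow> \<not> peval v \<phi>"
| "peval v (Conj \<phi> \<psi>) \<longleftrightarrow> peval v \<phi> \<and> peval v \<psi>"
| "peval v (Disj \<phi> \<psi>) \<longleftrightarrow> peval v \<phi> \<or> peval v \<psi>"
| "peval v (Imp \<phi> \<psi>) \<longleftrightarrow> (peval v \<phi> \<longrightarrow> peval v \<psi>)"
| "peval v (Iff \<phi> \<psi>) \<longleftrightarrow> (peval v \<phi> \<longleftrightarrow> peval v \<psi>)"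
| "peval v (Forall x \<phi>) \<longleftrightarrow> v (Forall x \<phi>)"
| "peval v (Exists x \<phi>) \<longleftrightarrow> v (Exists x \<phi>)"
| "peval v (Box X \<phi>) \<longleftrightarrow> v (Box X \<phi>)"
| "peval v (Just t X \<phi>) \<longleftrightarrow> v (Just t X \<phi>)"

definition tautology :: "form \<Rightarrow> bool" where
  "tautology \<phi> \<longleftrightarrow> (\<forall>v. peval v \<phi>)"

inductive axiom0 :: "form \<Rightarrow> bool" where
  taut: "tautology \<phi> \<Longrightarrow> axiom0 \<phi>"
| all_inst: "free_for (id(x := y)) \<phi> \<Longrightarrow> axiom0 (Imp (Forall x \<phi>) (subst (id(x := y)) \<phi>))"
| ex_inst: "free_for (id(x := y)) \<phi> \<Longrightarrow> axiom0 (Imp (subst (id(x := y)) \<phi>) (Exists x \<phi>))"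
| all_imp: "x \<notin> FV \<phi> \<Longrightarrow> axiom0 (Imp (Forall x (Imp \<phi> \<psi>)) (Imp \<phi> (Forall x \<psi>)))"
| ex_imp: "x \<notin> FV \<psi> \<Longrightarrow> axiom0 (Imp (Forall x (Imp \<phi> \<psi>)) (Imp (Exists x \<phi>) \<psi>))"

inductive axiom :: "form \<Rightarrow> bool" where
  A0: "axiom0 \<phi> \<Longrightarrow> axiom \<phi>"
| A1: "y \<notin> FV \<phi> \<Longrightarrow> axiom (Imp (Just t (finsert y X) \<phi>) (Just t X \<phi>))"
| A1': "y \<notin> FV \<phi> \<Longrightarrow> axiom (Imp (Box (finsert y X) \<phi>) (Box X \<phi>))"
| A2: "axiom (Imp (Just t X \<phi>) (Just t (finsert y X) \<phi>))"
| A2': "axiom (Imp (Box X \<phi>) (Box (finsert y X) \<phi>))"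
| A3: "axiom (Imp (Just t X \<phi>) \<phi>)"
| A3': "axiom (Imp (Box X \<phi>) \<phi>)"
| A4: "axiom (Imp (Just t X (Imp \<phi> \<psi>)) (Imp (Just s X \<phi>) (Just (App t s) X \<psi>)))"
| A4': "axiom (Imp (Box X (Imp \<phi> \<psi>)) (Imp (Box X \<phi>) (Box X \<psi>)))"
| A5_left: "axiom (Imp (Just t X \<phi>) (Just (Plus t s) X \<phi>))"
| A5_right: "axiom (Imp (Just s X \<phi>) (Just (Plus t s) X \<phi>))"
| A6: "axiom (Imp (Just t X \<phi>) (Just (Bang t) X (Just t X \<phi>)))"
| A6': "axiom (Imp (Box X \<phi>) (Box X (Box X \<phi>)))"
| A7: "x |\<notin>| X \<Longrightarrow> axiom (Imp (Just t X \<phi>) (Just (Gen x t) X (Forall x \<phi>)))"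
| A7': "x |\<notin>| X \<Longrightarrow> axiom (Imp (Box X \<phi>) (Box X (Forall x \<phi>)))"
| A8: "axiom (Imp (Just t X \<phi>) (Box X \<phi>))"

definition constant_spec :: "form set \<Rightarrow> bool" where
  "constant_spec CS \<longleftrightarrow> CS \<subseteq> {Just (JConst c) {||} \<phi> | c \<phi>. axiom \<phi>}"

inductive derives :: "form set \<Rightarrow> form set \<Rightarrow> form \<Rightarrow> bool" for CS \<Gamma> where
  hyp: "\<phi> \<in> \<Gamma> \<Longrightarrow> derives CS \<Gamma> \<phi>"
| ax: "axiom \<phi> \<Longrightarrow> derives CS \<Gamma> \<phi>"
| cs: "\<phi> \<in> CS \<Longrightarrow> derives CS \<Gamma> \<phi>"
| mp: "derives CS \<Gamma> (Imp \<phi> \<psi>) \<Longrightarrow> derives CS \<Gamma> \<phi> \<Longrightarrow> derives CS \<Gamma> \<psi>"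
| gen: "derives CS \<Gamma> \<phi> \<Longrightarrow> x \<notin> (\<Union>\<psi>\<in>\<Gamma>. FV \<psi>) \<Longrightarrow> derives CS \<Gamma> (Forall x \<phi>)"
| nec: "axiom \<phi> \<Longrightarrow> derives CS \<Gamma> (Box {||} \<phi>)"

text \<open>Finite valuations are partial maps with finite domain; restriction is \<open>f |` Y\<close>, and the
  restriction of a total \<open>\<nu>\<close> to \<open>Y\<close> is \<open>(Some \<circ> \<nu>) |` Y\<close>.\<close>

definition ext :: "(var \<rightharpoonup> 'd) \<Rightarrow> 'd set \<Rightarrow> (var \<rightharpoonup> 'd) set" where
  "ext f A = {g. finite (dom g) \<and> f \<subseteq>\<^sub>m g \<and> ran g \<subseteq> A}"

record ('w, 'd) fmodel =
  wld :: "'w set"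
  acc :: "('w \<times> 'w) set"
  dmn :: "'w \<Rightarrow> 'd set"
  intp :: "psym \<Rightarrow> 'w \<Rightarrow> 'd list set"
  evd :: "jterm \<Rightarrow> form \<Rightarrow> (var \<rightharpoonup> 'd) \<Rightarrow> 'w set"

definition full_dmn :: "('w, 'd) fmodel \<Rightarrow> 'd set" where
  "full_dmn M = (\<Union>w\<in>wld M. dmn M w)"

definition finval :: "('w, 'd) fmodel \<Rightarrow> (var \<rightharpoonup> 'd) set" where
  "finval M = {f. finite (dom f) \<and> ran f \<subseteq> full_dmn M}"

text \<open>In \<open>substitution\<close>, \<open>\<sigma>\<close> ranges over the replacements of finitely many variables of \<open>FV \<phi>\<close>.
  The composite \<open>f \<circ> \<sigma>\<close> is a valuation of (a part of) \<open>FV \<phi>\<close>, that is, \<open>\<sigma>\<close> is regarded as a map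
  from \<open>FV \<phi>\<close> to variables.  Without this restriction the case \<open>\<sigma> = id\<close> together with
  \<open>adequacy\<close> would force \<open>dmn M w = full_dmn M\<close> at every world \<open>w\<close> having any evidence at all.\<close>

locale fitting_model =
  fixes M :: "('w, 'd) fmodel"
  assumes worlds_nonempty: "wld M \<noteq> {}"
    and acc_worlds: "acc M \<subseteq> wld M \<times> wld M"
    and acc_refl: "refl_on (wld M) (acc M)"
    and acc_trans: "trans (acc M)"
    and dmn_nonempty: "w \<in> wld M \<Longrightarrow> dmn M w \<noteq> {}"
    and dmn_mono: "(w, u) \<in> acc M \<Longrightarrow> dmn M w \<subseteq> dmn M u"
    and intp_dmn: "w \<in> wld M \<Longrightarrow> intp M (p, n) w \<subseteq> {ds. length ds = n \<and> set ds \<subseteq> dmn M w}"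
    and evd_worlds: "f \<in> finval M \<Longrightarrow> evd M t \<phi> f \<subseteq> wld M"
    and adequacy: "f \<in> finval M \<Longrightarrow> w \<in> evd M t \<phi> f \<Longrightarrow> ran f \<subseteq> dmn M w"
    and substitution:
      "f \<in> finval M \<Longrightarrow> (\<And>x. x \<notin> FV \<phi> \<Longrightarrow> \<sigma> x = x) \<Longrightarrow> free_for \<sigma> \<phi> \<Longrightarrow>
       evd M t (subst \<sigma> \<phi>) (f |` FV (subst \<sigma> \<phi>)) = evd M t \<phi> ((f \<circ> \<sigma>) |` FV \<phi>)"
    and R_closure:
      "f \<in> finval M \<Longrightarrow> (w, u) \<in> acc M \<Longrightarrow> w \<in> evd M t \<phi> f \<Longrightarrow> u \<in> evd M t \<phi> f"
    and extension:
      "f \<in> finval M \<Longrightarrow> w \<in> evd M t \<phi> f \<Longrightarrow> g \<in> ext f (dmn M w) \<Longrightarrow> w \<in> evd M t \<phi> g"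
    and restriction: "f \<in> finval M \<Longrightarrow> evd M t \<phi> f \<subseteq> evd M t \<phi> (f |` FV \<phi>)"
    and evd_App:
      "f \<in> finval M \<Longrightarrow> evd M t (Imp \<phi> \<psi>) f \<inter> evd M s \<phi> f \<subseteq> evd M (App t s) \<psi> f"
    and evd_Plus: "f \<in> finval M \<Longrightarrow> evd M t \<phi> f \<union> evd M s \<phi> f \<subseteq> evd M (Plus t s) \<phi> f"
    and evd_Bang:
      "f \<in> finval M \<Longrightarrow> w \<in> evd M t \<phi> f \<Longrightarrow> g \<in> ext f (dmn M w) \<Longrightarrow>
       dom f \<inter> FV \<phi> \<subseteq> fset X \<Longrightarrow> fset X \<subseteq> dom g \<Longrightarrow> w \<in> evd M (Bang t) (Just t X \<phi>) g"
    and evd_Gen: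
      "f \<in> finval M \<Longrightarrow> x \<notin> dom f \<inter> FV \<phi> \<Longrightarrow> evd M t \<phi> f \<subseteq> evd M (Gen x t) (Forall x \<phi>) f"

definition meets :: "('w, 'd) fmodel \<Rightarrow> form set \<Rightarrow> bool" where
  "meets M CS \<longleftrightarrow> (\<forall>c \<phi>. Just (JConst c) {||} \<phi> \<in> CS \<longrightarrow> evd M (JConst c) \<phi> Map.empty = wld M)"

text \<open>The clauses for \<open>Disj\<close>, \<open>Imp\<close>, \<open>Iff\<close> and \<open>Exists\<close> are the unfoldings of the standard
  abbreviations; see the lemmas after the definition.\<close>

primrec sat :: "('w, 'd) fmodel \<Rightarrow> (var \<Rightarrow> 'd) \<Rightarrow> 'w \<Rightarrow> form \<Rightarrow> bool" where
  "sat M \<nu> w (Pred p xs) \<longleftrightarrow> map \<nu> xs \<in> intp M (p, length xs) w"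
| "sat M \<nu> w (Neg \<phi>) \<longleftrightarrow> \<nu> ` FV \<phi> \<subseteq> dmn M w \<and> \<not> sat M \<nu> w \<phi>"
| "sat M \<nu> w (Conj \<phi> \<psi>) \<longleftrightarrow> sat M \<nu> w \<phi> \<and> sat M \<nu> w \<psi>"
| "sat M \<nu> w (Disj \<phi> \<psi>) \<longleftrightarrow> \<nu> ` (FV \<phi> \<union> FV \<psi>) \<subseteq> dmn M w \<and>
     \<not> ((\<nu> ` FV \<phi> \<subseteq> dmn M w \<and> \<not> sat M \<nu> w \<phi>) \<and> (\<nu> ` FV \<psi> \<subseteq> dmn M w \<and> \<not> sat M \<nu> w \<psi>))"
| "sat M \<nu> w (Imp \<phi> \<psi>) \<longleftrightarrow> \<nu> ` (FV \<phi> \<union> FV \<psi>) \<subseteq> dmn M w \<and>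
     \<not> (sat M \<nu> w \<phi> \<and> (\<nu> ` FV \<psi> \<subseteq> dmn M w \<and> \<not> sat M \<nu> w \<psi>))"
| "sat M \<nu> w (Iff \<phi> \<psi>) \<longleftrightarrow>
     (\<nu> ` (FV \<phi> \<union> FV \<psi>) \<subseteq> dmn M w \<and>
       \<not> (sat M \<nu> w \<phi> \<and> (\<nu> ` FV \<psi> \<subseteq> dmn M w \<and> \<not> sat M \<nu> w \<psi>))) \<and>
     (\<nu> ` (FV \<psi> \<union> FV \<phi>) \<subseteq> dmn M w \<and>
       \<not> (sat M \<nu> w \<psi> \<and> (\<nu> ` FV \<phi> \<subseteq> dmn M w \<and> \<not> sat M \<nu> w \<phi>)))"
| "sat M \<nu> w (Forall x \<phi>) \<longleftrightarrow> (\<forall>a\<in>dmn M w. sat M (\<nu>(x := a)) w \<phi>)"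
| "sat M \<nu> w (Exists x \<phi>) \<longleftrightarrow> \<nu> ` (FV \<phi> - {x}) \<subseteq> dmn M w \<and>
     \<not> (\<forall>a\<in>dmn M w. (\<nu>(x := a)) ` FV \<phi> \<subseteq> dmn M w \<and> \<not> sat M (\<nu>(x := a)) w \<phi>)"
| "sat M \<nu> w (Box X \<phi>) \<longleftrightarrow> \<nu> ` fset X \<subseteq> dmn M w \<and>
     (\<forall>u \<delta>. (w, u) \<in> acc M \<longrightarrow> \<delta> ` (FV \<phi> - fset X) \<subseteq> dmn M u \<longrightarrow>
        sat M (override_on \<nu> \<delta> (FV \<phi> - fset X)) u \<phi>)"
| "sat M \<nu> w (Just t X \<phi>) \<longleftrightarrow> \<nu> ` fset X \<subseteq> dmn M w \<and>
     (\<forall>u \<delta>. (w, u) \<in> acc M \<longrightarrow> \<delta> ` (FV \<phi> - fset X) \<subseteq> dmn M u \<longrightarrow>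
        sat M (override_on \<nu> \<delta> (FV \<phi> - fset X)) u \<phi>) \<and>
     w \<in> evd M t \<phi> ((Some \<circ> \<nu>) |` (FV \<phi> \<inter> fset X))"

lemma sat_Disj_abbrev: "sat M \<nu> w (Disj \<phi> \<psi>) = sat M \<nu> w (Neg (Conj (Neg \<phi>) (Neg \<psi>)))"
  by (simp only: sat.simps FV.simps)

lemma sat_Imp_abbrev: "sat M \<nu> w (Imp \<phi> \<psi>) = sat M \<nu> w (Neg (Conj \<phi> (Neg \<psi>)))"
  by (simp only: sat.simps FV.simps)

lemma sat_Iff_abbrev: "sat M \<nu> w (Iff \<phi> \<psi>) = sat M \<nu> w (Conj (Imp \<phi> \<psi>) (Imp \<psi> \<phi>))"
  by (simp only: sat.simps)

lemma sat_Exists_abbrev: "sat M \<nu> w (Exists x \<phi>) = sat M \<nu> w (Neg (Forall x (Neg \<phi>)))"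
  by (simp only: sat.simps FV.simps)

end

theory Submission imports Defs begin

text \<open>
  Soundness by induction on derivations.  Truth of a formula at a world forces its free variables
  to denote elements of that world's domain, and truth depends only on the values of the free
  variables; together they let modus ponens go through although the cut formula may mention
  variables denoting objects that do not exist at the world.  The quantifier axioms rest on the
  substitution lemma \<open>\<nu> \<Vdash> \<Phi>\<sigma> \<longleftrightarrow> \<nu> \<circ> \<sigma> \<Vdash> \<Phi>\<close>, whose case \<open>t :\<^sub>X \<Phi>\<close>
  is the substitution condition on evidence.  In the justification axioms, evidence for
  subformulas with different free variables is brought to a common valuation by the extension
  condition and cut back by the restriction condition.
\<close>

section \<open>Substitution and free variables\<close>

lemma subst_cong:
  "(\<And>x. x \<in> FV \<phi> \<Longrightarrow> \<sigma> x = \<tau> x) \<Longrightarrow> subst \<sigma> \<phi> = subst \<tau> \<phi>"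
proof (induction \<phi> arbitrary: \<sigma> \<tau>)
  case (Box X \<phi>)
  have "subst (override_on id \<sigma> (fset X)) \<phi> = subst (override_on id \<tau> (fset X)) \<phi>"
    by (rule Box.IH) (use Box.prems in \<open>auto simp: override_on_def\<close>)
  moreover have "\<sigma> |`| X = \<tau> |`| X"
    by (rule fset.map_cong0) (use Box.prems in auto)
  ultimately show ?case by simp
next
  case (Just t X \<phi>)
  have "subst (override_on id \<sigma> (fset X)) \<phi> = subst (override_on id \<tau> (fset X)) \<phi>"
    by (rule Just.IH) (use Just.prems in \<open>auto simp: override_on_def\<close>)
  moreover have "\<sigma> |`| X = \<tau> |`| X"
    by (rule fset.map_cong0) (use Just.prems in auto)
  ultimately show ?case by simp
next
  case (Forall x \<phi>)
  have "subst (\<sigma>(x := x)) \<phi> = subst (\<tau>(x := x)) \<phi>"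
    by (rule Forall.IH) (use Forall.prems in auto)
  then show ?case by simp
next
  case (Exists x \<phi>)
  have "subst (\<sigma>(x := x)) \<phi> = subst (\<tau>(x := x)) \<phi>"
    by (rule Exists.IH) (use Exists.prems in auto)
  then show ?case by simp
next
  case (Neg \<phi>)
  show ?case using Neg.IH[of \<sigma> \<tau>] Neg.prems by simp
next
  case (Conj \<phi> \<psi>)
  show ?case using Conj.IH(1)[of \<sigma> \<tau>] Conj.IH(2)[of \<sigma> \<tau>] Conj.prems by simp
next
  case (Disj \<phi> \<psi>)
  show ?case using Disj.IH(1)[of \<sigma> \<tau>] Disj.IH(2)[of \<sigma> \<tau>] Disj.prems by simp
next
  case (Imp \<phi> \<psi>)
  show ?case using Imp.IH(1)[of \<sigma> \<tau>] Imp.IH(2)[of \<sigma> \<tau>] Imp.prems by simp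
next
  case (Iff \<phi> \<psi>)
  show ?case using Iff.IH(1)[of \<sigma> \<tau>] Iff.IH(2)[of \<sigma> \<tau>] Iff.prems by simp
qed simp

text \<open>Together with \<open>subst_cong\<close> this allows a substitution to be replaced by one
  that moves free variables only, the form in which evidence is closed under substitution.\<close>

lemma free_for_cong:
  "free_for \<sigma> \<phi> \<Longrightarrow> (\<And>x. x \<in> FV \<phi> \<Longrightarrow> \<sigma> x = \<tau> x) \<Longrightarrow> free_for \<tau> \<phi>"
proof (induction \<phi> arbitrary: \<sigma> \<tau>)
  case (Box X \<phi>)
  have "free_for (override_on id \<tau> (fset X)) \<phi>"
    by (rule Box.IH[of "override_on id \<sigma> (fset X)"])
      (use Box.prems in \<open>auto simp: override_on_def\<close>)
  moreover have "\<sigma> ` fset X = \<tau> ` fset X"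
    by (rule image_cong) (use Box.prems in auto)
  ultimately show ?case using Box.prems(1) by simp
next
  case (Just t X \<phi>)
  have "free_for (override_on id \<tau> (fset X)) \<phi>"
    by (rule Just.IH[of "override_on id \<sigma> (fset X)"])
      (use Just.prems in \<open>auto simp: override_on_def\<close>)
  moreover have "\<sigma> ` fset X = \<tau> ` fset X"
    by (rule image_cong) (use Just.prems in auto)
  ultimately show ?case using Just.prems(1) by simp
next
  case (Forall x \<phi>)
  have "free_for (\<sigma>(x := x)) \<phi>" using Forall.prems(1) by simp
  then have "free_for (\<tau>(x := x)) \<phi>" by (rule Forall.IH) (use Forall.prems(2) in simp)
  moreover have "\<sigma> ` (FV \<phi> - {x}) = \<tau> ` (FV \<phi> - {x})"
    by (rule image_cong) (use Forall.prems in auto)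
  ultimately show ?case using Forall.prems(1) by simp
next
  case (Exists x \<phi>)
  have "free_for (\<sigma>(x := x)) \<phi>" using Exists.prems(1) by simp
  then have "free_for (\<tau>(x := x)) \<phi>" by (rule Exists.IH) (use Exists.prems(2) in simp)
  moreover have "\<sigma> ` (FV \<phi> - {x}) = \<tau> ` (FV \<phi> - {x})"
    by (rule image_cong) (use Exists.prems in auto)
  ultimately show ?case using Exists.prems(1) by simp
next
  case (Neg \<phi>)
  show ?case using Neg.IH[of \<sigma> \<tau>] Neg.prems by simp
next
  case (Conj \<phi> \<psi>)
  show ?case using Conj.IH(1)[of \<sigma> \<tau>] Conj.IH(2)[of \<sigma> \<tau>] Conj.prems by simp
next
  case (Disj \<phi> \<psi>)
  show ?case using Disj.IH(1)[of \<sigma> \<tau>] Disj.IH(2)[of \<sigma> \<tau>] Disj.prems by simp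
next
  case (Imp \<phi> \<psi>)
  show ?case using Imp.IH(1)[of \<sigma> \<tau>] Imp.IH(2)[of \<sigma> \<tau>] Imp.prems by simp
next
  case (Iff \<phi> \<psi>)
  show ?case using Iff.IH(1)[of \<sigma> \<tau>] Iff.IH(2)[of \<sigma> \<tau>] Iff.prems by simp
qed simp

text \<open>Absence of capture gives equality: no other free variable is sent to the quantified one,
  so deleting \<open>x\<close> after the substitution removes nothing else. For the modalities both
  sides are the image of the index set.\<close>

lemma FV_subst: "free_for \<sigma> \<phi> \<Longrightarrow> FV (subst \<sigma> \<phi>) = \<sigma> ` FV \<phi>"
proof (induction \<phi> arbitrary: \<sigma>)
  case (Forall x \<phi>)
  have "FV (subst (\<sigma>(x := x)) \<phi>) = (\<sigma>(x := x)) ` FV \<phi>"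
    using Forall.prems by (intro Forall.IH) (simp only: free_for.simps)
  with Forall.prems show ?case by auto
next
  case (Exists x \<phi>)
  have "FV (subst (\<sigma>(x := x)) \<phi>) = (\<sigma>(x := x)) ` FV \<phi>"
    using Exists.prems by (intro Exists.IH) (simp only: free_for.simps)
  with Exists.prems show ?case by auto
qed (simp_all add: image_Un)

section \<open>Coincidence of valuations and elimination of modalities\<close>

lemma sat_cong:
  "(\<And>x. x \<in> FV \<phi> \<Longrightarrow> \<nu> x = \<mu> x) \<Longrightarrow> sat M \<nu> w \<phi> = sat M \<mu> w \<phi>"
proof (induction \<phi> arbitrary: \<nu> \<mu> w)
  case (Pred p xs)
  then have "map \<nu> xs = map \<mu> xs" by simp
  then show ?case by (simp only: sat.simps)
next
  case (Neg \<phi>)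
  have "sat M \<nu> w \<phi> = sat M \<mu> w \<phi>" by (rule Neg.IH) (use Neg.prems in auto)
  moreover have "\<nu> ` FV \<phi> = \<mu> ` FV \<phi>" by (rule image_cong) (use Neg.prems in auto)
  ultimately show ?case by (simp only: sat.simps)
next
  case (Conj \<phi> \<psi>)
  show ?case using Conj.IH(1)[of \<nu> \<mu>] Conj.IH(2)[of \<nu> \<mu>] Conj.prems by simp
next
  case (Disj \<phi> \<psi>)
  have "sat M \<nu> w \<phi> = sat M \<mu> w \<phi>" "sat M \<nu> w \<psi> = sat M \<mu> w \<psi>"
    by (rule Disj.IH; use Disj.prems in auto)+
  moreover have "\<nu> ` FV \<phi> = \<mu> ` FV \<phi>" "\<nu> ` FV \<psi> = \<mu> ` FV \<psi>"
    by (rule image_cong; use Disj.prems in auto)+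
  ultimately show ?case by (simp only: sat.simps image_Un)
next
  case (Imp \<phi> \<psi>)
  have "sat M \<nu> w \<phi> = sat M \<mu> w \<phi>" "sat M \<nu> w \<psi> = sat M \<mu> w \<psi>"
    by (rule Imp.IH; use Imp.prems in auto)+
  moreover have "\<nu> ` FV \<phi> = \<mu> ` FV \<phi>" "\<nu> ` FV \<psi> = \<mu> ` FV \<psi>"
    by (rule image_cong; use Imp.prems in auto)+
  ultimately show ?case by (simp only: sat.simps image_Un)
next
  case (Iff \<phi> \<psi>)
  have "sat M \<nu> w \<phi> = sat M \<mu> w \<phi>" "sat M \<nu> w \<psi> = sat M \<mu> w \<psi>"
    by (rule Iff.IH; use Iff.prems in auto)+
  moreover have "\<nu> ` FV \<phi> = \<mu> ` FV \<phi>" "\<nu> ` FV \<psi> = \<mu> ` FV \<psi>"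
    by (rule image_cong; use Iff.prems in auto)+
  ultimately show ?case by (simp only: sat.simps image_Un)
next
  case (Forall x \<phi>)
  have "sat M (\<nu>(x := a)) w \<phi> = sat M (\<mu>(x := a)) w \<phi>" for a
    by (rule Forall.IH) (use Forall.prems in auto)
  then show ?case by (simp only: sat.simps)
next
  case (Exists x \<phi>)
  have "sat M (\<nu>(x := a)) w \<phi> = sat M (\<mu>(x := a)) w \<phi>" for a
    by (rule Exists.IH) (use Exists.prems in auto)
  moreover have "(\<nu>(x := a)) ` FV \<phi> = (\<mu>(x := a)) ` FV \<phi>" for a
    by (rule image_cong) (use Exists.prems in auto)
  moreover have "\<nu> ` (FV \<phi> - {x}) = \<mu> ` (FV \<phi> - {x})"
    by (rule image_cong) (use Exists.prems in auto)
  ultimately show ?case by (simp only: sat.simps)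
next
  case (Box X \<phi>)
  have "sat M (override_on \<nu> \<delta> (FV \<phi> - fset X)) u \<phi> = sat M (override_on \<mu> \<delta> (FV \<phi> - fset X)) u \<phi>"
    for u \<delta>
    by (rule Box.IH) (use Box.prems in \<open>auto simp: override_on_def\<close>)
  moreover have "\<nu> ` fset X = \<mu> ` fset X"
    by (rule image_cong) (use Box.prems in auto)
  ultimately show ?case by (simp only: sat.simps)
next
  case (Just t X \<phi>)
  have "sat M (override_on \<nu> \<delta> (FV \<phi> - fset X)) u \<phi> = sat M (override_on \<mu> \<delta> (FV \<phi> - fset X)) u \<phi>"
    for u \<delta>
    by (rule Just.IH) (use Just.prems in \<open>auto simp: override_on_def\<close>)
  moreover have "\<nu> ` fset X = \<mu> ` fset X"
    by (rule image_cong) (use Just.prems in auto)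
  moreover have "(Some \<circ> \<nu>) |` (FV \<phi> \<inter> fset X) = (Some \<circ> \<mu>) |` (FV \<phi> \<inter> fset X)"
    using Just.prems by (auto simp: restrict_map_def fun_eq_iff)
  ultimately show ?case by (simp only: sat.simps)
qed

text \<open>Reduces each axiom about justification terms to its counterpart for \<open>Box\<close>
  and a condition on evidence.\<close>

lemma sat_Just_iff:
  "sat M \<nu> w (Just t X \<phi>) \<longleftrightarrow>
     sat M \<nu> w (Box X \<phi>) \<and> w \<in> evd M t \<phi> ((Some \<circ> \<nu>) |` (FV \<phi> \<inter> fset X))"
  by (simp only: sat.simps) blast

text \<open>Here \<open>\<mu>\<close> itself serves as the reassignment \<open>\<delta>\<close>, so
  that later proofs need no overriding.\<close>

lemma sat_BoxD:
  assumes "sat M \<nu> w (Box X \<phi>)" "(w, u) \<in> acc M"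
    and "\<And>x. x \<in> fset X \<Longrightarrow> \<mu> x = \<nu> x" "\<mu> ` (FV \<phi> - fset X) \<subseteq> dmn M u"
  shows "sat M \<mu> u \<phi>"
proof -
  have "sat M (override_on \<nu> \<mu> (FV \<phi> - fset X)) u \<phi>"
    using assms(1,2,4) by simp
  moreover have "sat M (override_on \<nu> \<mu> (FV \<phi> - fset X)) u \<phi> = sat M \<mu> u \<phi>"
    by (rule sat_cong) (use assms(3) in \<open>auto simp: override_on_def\<close>)
  ultimately show ?thesis by simp
qed

section \<open>Domains, finite valuations and introduction of modalities\<close>

context fitting_model
begin

lemma acc_world: "(w, u) \<in> acc M \<Longrightarrow> w \<in> wld M \<and> u \<in> wld M"
  using acc_worlds by blast

lemma dmn_full: "w \<in> wld M \<Longrightarrow> dmn M w \<subseteq> full_dmn M"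
  by (auto simp: full_dmn_def)

lemma restricted_valuation_finval:
  "range \<nu> \<subseteq> full_dmn M \<Longrightarrow> finite Y \<Longrightarrow> (Some \<circ> \<nu>) |` Y \<in> finval M"
  by (auto simp: finval_def ran_def restrict_map_def dom_def split: if_splits)

lemma restricted_valuation_ext:
  "Y \<subseteq> Z \<Longrightarrow> finite Z \<Longrightarrow> \<nu> ` Z \<subseteq> A \<Longrightarrow> (Some \<circ> \<nu>) |` Z \<in> ext ((Some \<circ> \<nu>) |` Y) A"
  by (auto simp: ext_def ran_def restrict_map_def dom_def map_le_def split: if_splits)

text \<open>Most clauses carry this condition themselves, and atoms obtain it from
  \<open>intp_dmn\<close>. For \<open>Forall\<close> some instance must exist, hence the appeal to a
  nonempty domain; the instance leaves the values of variables other than \<open>x\<close>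
  untouched.\<close>

lemma sat_FV_dmn: "w \<in> wld M \<Longrightarrow> sat M \<nu> w \<phi> \<Longrightarrow> \<nu> ` FV \<phi> \<subseteq> dmn M w"
proof (induction \<phi> arbitrary: \<nu>)
  case (Pred p xs)
  then have "map \<nu> xs \<in> {ds. length ds = length xs \<and> set ds \<subseteq> dmn M w}"
    using intp_dmn[of w p "length xs"] unfolding sat.simps by blast
  then show ?case by simp
next
  case (Forall x \<phi>)
  obtain a where a: "a \<in> dmn M w" using dmn_nonempty Forall.prems(1) by blast
  then have "sat M (\<nu>(x := a)) w \<phi>" using Forall.prems(2) by simp
  then have "(\<nu>(x := a)) ` FV \<phi> \<subseteq> dmn M w" by (rule Forall.IH[OF Forall.prems(1)])
  then show ?case by (auto split: if_splits)
next
  case (Conj \<phi> \<psi>)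
  then show ?case by (simp add: image_Un)
qed (simp_all only: sat.simps FV.simps)

text \<open>Each reassignment allowed by the truth clause is such a \<open>\<mu>\<close>: the new
  values lie in \<open>dmn M u\<close>, hence in the full domain, and the values on \<open>X\<close>
  pass from \<open>w\<close> to \<open>u\<close> by monotonicity of domains.\<close>

lemma sat_BoxI:
  assumes "w \<in> wld M" "range \<nu> \<subseteq> full_dmn M" "\<nu> ` fset X \<subseteq> dmn M w"
    and step: "\<And>u \<mu>. (w, u) \<in> acc M \<Longrightarrow> range \<mu> \<subseteq> full_dmn M \<Longrightarrow>
      (\<And>x. x \<in> fset X \<Longrightarrow> \<mu> x = \<nu> x) \<Longrightarrow> \<mu> ` (FV \<phi> \<union> fset X) \<subseteq> dmn M u \<Longrightarrow> sat M \<mu> u \<phi>"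
  shows "sat M \<nu> w (Box X \<phi>)"
proof -
  have "sat M (override_on \<nu> \<delta> (FV \<phi> - fset X)) u \<phi>"
    if u: "(w, u) \<in> acc M" and \<delta>: "\<delta> ` (FV \<phi> - fset X) \<subseteq> dmn M u" for u \<delta>
  proof (rule step[OF u])
    have "dmn M u \<subseteq> full_dmn M" using acc_world[OF u] dmn_full by blast
    then show "range (override_on \<nu> \<delta> (FV \<phi> - fset X)) \<subseteq> full_dmn M"
      using assms(2) \<delta> by (auto simp: override_on_def)
    show "override_on \<nu> \<delta> (FV \<phi> - fset X) x = \<nu> x" if "x \<in> fset X" for x
      using that by (simp add: override_on_def)
    show "override_on \<nu> \<delta> (FV \<phi> - fset X) ` (FV \<phi> \<union> fset X) \<subseteq> dmn M u"
      using assms(3) \<delta> dmn_mono[OF u] by (auto simp: override_on_def)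
  qed
  with assms(3) show ?thesis by simp
qed

lemma sat_Imp_iff:
  assumes "\<nu> ` FV (Imp \<phi> \<psi>) \<subseteq> dmn M w"
  shows "sat M \<nu> w (Imp \<phi> \<psi>) \<longleftrightarrow> (sat M \<nu> w \<phi> \<longrightarrow> sat M \<nu> w \<psi>)"
  using assms by (auto simp: image_Un)

lemma sat_Exists_iff:
  "sat M \<nu> w (Exists x \<phi>) \<longleftrightarrow>
     \<nu> ` FV (Exists x \<phi>) \<subseteq> dmn M w \<and> (\<exists>a\<in>dmn M w. sat M (\<nu>(x := a)) w \<phi>)"
proof -
  have "(\<nu>(x := a)) ` FV \<phi> \<subseteq> dmn M w"
    if "\<nu> ` (FV \<phi> - {x}) \<subseteq> dmn M w" "a \<in> dmn M w" for a
    using that by auto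
  then show ?thesis unfolding sat.simps FV.simps by blast
qed

section \<open>The substitution lemma\<close>

text \<open>Shared by the cases \<open>Box\<close> and \<open>Just\<close>, hence the induction
  hypothesis as an assumption. Without capture the modality binds the same set \<open>Y\<close>
  before and after substitution, so both sides quantify over the same
  \<open>\<delta>\<close>.\<close>

lemma sat_subst_Box:
  fixes \<sigma> :: "var \<Rightarrow> var" and X :: "var fset"
  defines "\<tau> \<equiv> override_on id \<sigma> (fset X)"
  assumes IH: "\<And>\<nu> w. range \<nu> \<subseteq> full_dmn M \<Longrightarrow> w \<in> wld M \<Longrightarrow>
      sat M \<nu> w (subst \<tau> \<phi>) = sat M (\<nu> \<circ> \<tau>) w \<phi>"
    and ff: "free_for \<sigma> (Box X \<phi>)" and \<nu>: "range \<nu> \<subseteq> full_dmn M" and w: "w \<in> wld M"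
  shows "sat M \<nu> w (subst \<sigma> (Box X \<phi>)) = sat M (\<nu> \<circ> \<sigma>) w (Box X \<phi>)"
proof -
  define Y where "Y = FV \<phi> - fset X"
  have disj: "\<sigma> ` fset X \<inter> Y = {}" and ff\<tau>: "free_for \<tau> \<phi>"
    using ff by (auto simp: Y_def \<tau>_def)
  \<comment> \<open>\<open>\<tau>\<close> fixes \<open>Y\<close> pointwise and acts as
    \<open>\<sigma>\<close> on \<open>X\<close>, whose image misses \<open>Y\<close>; removing that
    image leaves exactly \<open>Y\<close>.\<close>
  have Y: "FV (subst \<tau> \<phi>) - \<sigma> ` fset X = Y"
    using disj unfolding FV_subst[OF ff\<tau>]
    by (auto simp: Y_def \<tau>_def override_on_def image_iff split: if_splits)
  have "sat M (override_on \<nu> \<delta> Y) u (subst \<tau> \<phi>) = sat M (override_on (\<nu> \<circ> \<sigma>) \<delta> Y) u \<phi>"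
    if u: "(w, u) \<in> acc M" and \<delta>: "\<delta> ` Y \<subseteq> dmn M u" for u \<delta>
  proof -
    have uw: "u \<in> wld M" using acc_world[OF u] by blast
    have "range (override_on \<nu> \<delta> Y) \<subseteq> full_dmn M"
      using \<nu> \<delta> dmn_full[OF uw] by (auto simp: override_on_def)
    then have "sat M (override_on \<nu> \<delta> Y) u (subst \<tau> \<phi>) = sat M (override_on \<nu> \<delta> Y \<circ> \<tau>) u \<phi>"
      using IH uw by blast
    also have "\<dots> = sat M (override_on (\<nu> \<circ> \<sigma>) \<delta> Y) u \<phi>"
      by (rule sat_cong) (use disj in \<open>auto simp: override_on_def \<tau>_def Y_def\<close>)
    finally show ?thesis .
  qed
  then show ?thesis
    using Y by (auto simp: \<tau>_def[symmetric] Y_def[symmetric] image_comp)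
qed

lemma evd_subst:
  fixes \<sigma> :: "var \<Rightarrow> var" and X :: "var fset"
  defines "\<tau> \<equiv> override_on id \<sigma> (fset X)"
  assumes ff: "free_for \<sigma> (Just t X \<phi>)" and \<nu>: "range \<nu> \<subseteq> full_dmn M"
  shows "evd M t (subst \<tau> \<phi>) ((Some \<circ> \<nu>) |` (FV (subst \<tau> \<phi>) \<inter> \<sigma> ` fset X)) =
    evd M t \<phi> ((Some \<circ> (\<nu> \<circ> \<sigma>)) |` (FV \<phi> \<inter> fset X))"
proof -
  \<comment> \<open>The substitution condition on evidence only admits replacements that fix all variables
    outside \<^term>\<open>FV \<phi>\<close>.\<close>
  define \<rho> where "\<rho> = override_on id \<tau> (FV \<phi>)"
  define f where "f = (Some \<circ> \<nu>) |` (\<sigma> ` fset X)"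
  have disj: "\<sigma> ` fset X \<inter> (FV \<phi> - fset X) = {}" and ff\<tau>: "free_for \<tau> \<phi>"
    using ff by (auto simp: \<tau>_def)
  have \<rho>: "\<tau> x = \<rho> x" if "x \<in> FV \<phi>" for x
    using that by (simp add: \<rho>_def override_on_def)
  have "f \<in> finval M"
    unfolding f_def by (rule restricted_valuation_finval[OF \<nu>]) simp
  then have "evd M t (subst \<rho> \<phi>) (f |` FV (subst \<rho> \<phi>)) = evd M t \<phi> ((f \<circ> \<rho>) |` FV \<phi>)"
    by (rule substitution) (use free_for_cong[OF ff\<tau> \<rho>] in \<open>auto simp: \<rho>_def override_on_def\<close>)
  moreover have "subst \<tau> \<phi> = subst \<rho> \<phi>"
    by (rule subst_cong[OF \<rho>])
  \<comment> \<open>A free variable outside \<open>X\<close> is fixed by \<open>\<rho>\<close> and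
    lies outside the image of \<open>X\<close>, so the composite is undefined there, as the
    restriction on the right requires.\<close>
  moreover have "(f \<circ> \<rho>) |` FV \<phi> = (Some \<circ> (\<nu> \<circ> \<sigma>)) |` (FV \<phi> \<inter> fset X)"
    using disj
    by (auto simp: f_def \<rho>_def \<tau>_def override_on_def restrict_map_def fun_eq_iff)
  ultimately show ?thesis
    by (simp add: f_def Int_commute)
qed

text \<open>The range condition makes restrictions of \<open>\<nu>\<close> finite valuations in the
  sense of the evidence conditions; updates with elements of a world's domain preserve it.\<close>

lemma sat_subst:
  assumes "free_for \<sigma> \<phi>" "range \<nu> \<subseteq> full_dmn M" "w \<in> wld M"
  shows "sat M \<nu> w (subst \<sigma> \<phi>) = sat M (\<nu> \<circ> \<sigma>) w \<phi>"
  using assms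
proof (induction \<phi> arbitrary: \<sigma> \<nu> w)
  case (Pred p xs)
  then show ?case by (simp add: comp_def)
next
  case (Neg \<phi>)
  then show ?case by (simp add: FV_subst image_comp)
next
  case (Conj \<phi> \<psi>)
  then show ?case by simp
next
  case (Disj \<phi> \<psi>)
  then show ?case by (simp add: FV_subst image_Un image_comp)
next
  case (Imp \<phi> \<psi>)
  then show ?case by (simp add: FV_subst image_Un image_comp)
next
  case (Iff \<phi> \<psi>)
  then show ?case by (simp add: FV_subst image_Un image_comp)
next
  case (Forall x \<phi>)
  have "sat M (\<nu>(x := a)) w (subst (\<sigma>(x := x)) \<phi>) = sat M ((\<nu> \<circ> \<sigma>)(x := a)) w \<phi>"
    if "a \<in> dmn M w" for a
  proof -
    have "a \<in> full_dmn M" using that Forall.prems(3) dmn_full by blast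
    then have "range (\<nu>(x := a)) \<subseteq> full_dmn M" using Forall.prems(2) by auto
    moreover have "free_for (\<sigma>(x := x)) \<phi>" using Forall.prems(1) by simp
    ultimately have "sat M (\<nu>(x := a)) w (subst (\<sigma>(x := x)) \<phi>) =
        sat M (\<nu>(x := a) \<circ> \<sigma>(x := x)) w \<phi>"
      using Forall.IH Forall.prems(3) by blast
    \<comment> \<open>\<open>free_for\<close> rules out \<open>\<sigma> z = x\<close> for any other
      free \<open>z\<close>, so on free variables the update at \<open>x\<close> commutes with the
      composition.\<close>
    also have "\<dots> = sat M ((\<nu> \<circ> \<sigma>)(x := a)) w \<phi>"
      by (rule sat_cong) (use Forall.prems(1) in auto)
    finally show ?thesis .
  qed
  then show ?case by (simp add: comp_def)
next
  case (Exists x \<phi>)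
  have "sat M (\<nu>(x := a)) w (subst (\<sigma>(x := x)) \<phi>) = sat M ((\<nu> \<circ> \<sigma>)(x := a)) w \<phi>"
    if "a \<in> dmn M w" for a
  proof -
    have "a \<in> full_dmn M" using that Exists.prems(3) dmn_full by blast
    then have "range (\<nu>(x := a)) \<subseteq> full_dmn M" using Exists.prems(2) by auto
    moreover have "free_for (\<sigma>(x := x)) \<phi>" using Exists.prems(1) by simp
    ultimately have "sat M (\<nu>(x := a)) w (subst (\<sigma>(x := x)) \<phi>) =
        sat M (\<nu>(x := a) \<circ> \<sigma>(x := x)) w \<phi>"
      using Exists.IH Exists.prems(3) by blast
    also have "\<dots> = sat M ((\<nu> \<circ> \<sigma>)(x := a)) w \<phi>"
      by (rule sat_cong) (use Exists.prems(1) in auto)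
    finally show ?thesis .
  qed
  moreover have "\<nu> ` FV (subst \<sigma> (Exists x \<phi>)) = (\<nu> \<circ> \<sigma>) ` FV (Exists x \<phi>)"
    by (simp only: FV_subst[OF Exists.prems(1)] image_comp)
  ultimately show ?case
    unfolding subst.simps sat_Exists_iff by simp
next
  case (Box X \<phi>)
  show ?case
    by (rule sat_subst_Box[OF Box.IH Box.prems]) (use Box.prems(1) in simp_all)
next
  case (Just t X \<phi>)
  have "sat M \<nu> w (subst \<sigma> (Box X \<phi>)) = sat M (\<nu> \<circ> \<sigma>) w (Box X \<phi>)"
    by (rule sat_subst_Box[OF Just.IH _ Just.prems(2,3)]) (use Just.prems(1) in simp_all)
  then show ?case
    unfolding subst.simps sat_Just_iff fset.set_map evd_subst[OF Just.prems(1,2)] by simp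
qed

section \<open>First-order axioms\<close>

text \<open>Once all free variables exist at \<open>w\<close>, the domain guards hold for the
  formula and its propositional constituents, and truth at \<open>w\<close> is itself a
  propositional valuation.\<close>

lemma sat_tautology:
  assumes "tautology \<phi>" "\<nu> ` FV \<phi> \<subseteq> dmn M w"
  shows "sat M \<nu> w \<phi>"
proof -
  have "peval (sat M \<nu> w) \<psi> = sat M \<nu> w \<psi>" if "\<nu> ` FV \<psi> \<subseteq> dmn M w" for \<psi>
    using that by (induction \<psi>) (auto simp: image_Un)
  with assms show ?thesis by (auto simp: tautology_def)
qed

lemma axiom0_sound:
  assumes "axiom0 \<phi>" "w \<in> wld M" "range \<nu> \<subseteq> full_dmn M" "\<nu> ` FV \<phi> \<subseteq> dmn M w"
  shows "sat M \<nu> w \<phi>"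
  using assms
proof cases
  case taut
  then show ?thesis using sat_tautology assms(4) by blast
next
  case (all_inst x y \<psi>)
  have "sat M \<nu> w (subst (id(x := y)) \<psi>)" if all: "sat M \<nu> w (Forall x \<psi>)"
  proof -
    \<comment> \<open>The witness is \<open>\<nu> y\<close> when \<open>x\<close> is free. Otherwise
      \<open>y\<close> need not occur free in the axiom and \<open>\<nu> y\<close> may lie outside
      the domain, so any element is taken.\<close>
    obtain a where a: "a \<in> dmn M w" "x \<in> FV \<psi> \<Longrightarrow> a = \<nu> y"
    proof (cases "x \<in> FV \<psi>")
      case True
      then have "y \<in> FV \<phi>" using all_inst by (auto simp: FV_subst)
      with that assms(4) show thesis by auto
    next
      case False
      with that dmn_nonempty[OF assms(2)] show thesis by blast
    qed
    from all a(1) have "sat M (\<nu>(x := a)) w \<psi>" by simp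
    also have "sat M (\<nu>(x := a)) w \<psi> = sat M (\<nu> \<circ> id(x := y)) w \<psi>"
      by (rule sat_cong) (use a(2) in auto)
    finally show ?thesis using sat_subst[OF all_inst(2) assms(3,2)] by simp
  qed
  then show ?thesis using assms(4) sat_Imp_iff unfolding all_inst(1) by blast
next
  case (ex_inst x y \<psi>)
  have "sat M \<nu> w (Exists x \<psi>)" if inst: "sat M \<nu> w (subst (id(x := y)) \<psi>)"
  proof -
    obtain a where a: "a \<in> dmn M w" "x \<in> FV \<psi> \<Longrightarrow> a = \<nu> y"
    proof (cases "x \<in> FV \<psi>")
      case True
      then have "y \<in> FV \<phi>" using ex_inst by (auto simp: FV_subst)
      with that assms(4) show thesis by auto
    next
      case False
      with that dmn_nonempty[OF assms(2)] show thesis by blast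
    qed
    have "sat M (\<nu> \<circ> id(x := y)) w \<psi>"
      using inst sat_subst[OF ex_inst(2) assms(3,2)] by simp
    also have "sat M (\<nu> \<circ> id(x := y)) w \<psi> = sat M (\<nu>(x := a)) w \<psi>"
      by (rule sat_cong) (use a(2) in auto)
    finally show ?thesis
      using a(1) assms(4) unfolding ex_inst(1) sat_Exists_iff by auto
  qed
  then show ?thesis using assms(4) sat_Imp_iff unfolding ex_inst(1) by blast
next
  case (all_imp x \<psi> \<chi>)
  have "sat M \<nu> w (Forall x \<chi>)" if all: "sat M \<nu> w (Forall x (Imp \<psi> \<chi>))" and \<psi>: "sat M \<nu> w \<psi>"
  proof -
    have "sat M (\<nu>(x := a)) w \<chi>" if a: "a \<in> dmn M w" for a
    proof -
      have "sat M (\<nu>(x := a)) w (Imp \<psi> \<chi>)" using all a by simp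
      moreover have "sat M (\<nu>(x := a)) w \<psi> = sat M \<nu> w \<psi>"
        by (rule sat_cong) (use all_imp(2) in auto)
      ultimately show ?thesis using \<psi> by (auto simp: image_Un)
    qed
    then show ?thesis by simp
  qed
  moreover have "\<nu> ` FV (Imp \<psi> (Forall x \<chi>)) \<subseteq> dmn M w"
    using assms(4) all_imp by auto
  ultimately show ?thesis using assms(4) sat_Imp_iff unfolding all_imp(1) by metis
next
  case (ex_imp x \<chi> \<psi>)
  have "sat M \<nu> w \<chi>" if all: "sat M \<nu> w (Forall x (Imp \<psi> \<chi>))" and ex: "sat M \<nu> w (Exists x \<psi>)"
  proof -
    obtain a where a: "a \<in> dmn M w" "sat M (\<nu>(x := a)) w \<psi>"
      using ex unfolding sat_Exists_iff by blast
    then have "sat M (\<nu>(x := a)) w (Imp \<psi> \<chi>)" using all by simp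
    then have "sat M (\<nu>(x := a)) w \<chi>" using a(2) by (auto simp: image_Un)
    moreover have "sat M (\<nu>(x := a)) w \<chi> = sat M \<nu> w \<chi>"
      by (rule sat_cong) (use ex_imp(2) in auto)
    ultimately show ?thesis by simp
  qed
  moreover have "\<nu> ` FV (Imp (Exists x \<psi>) \<chi>) \<subseteq> dmn M w"
    using assms(4) ex_imp by auto
  ultimately show ?thesis using assms(4) sat_Imp_iff unfolding ex_imp(1) by metis
qed

section \<open>Axioms for \<open>Box\<close>\<close>

text \<open>As \<open>y\<close> is not free in the body, both modalities bind the same
  variables.\<close>

lemma sat_Box_remove:
  assumes "y \<notin> FV \<phi>" "sat M \<nu> w (Box (finsert y X) \<phi>)"
  shows "sat M \<nu> w (Box X \<phi>)"
  using assms by auto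

lemma sat_Box_insert:
  assumes w: "w \<in> wld M" and \<nu>: "range \<nu> \<subseteq> full_dmn M" and y: "\<nu> y \<in> dmn M w"
    and box: "sat M \<nu> w (Box X \<phi>)"
  shows "sat M \<nu> w (Box (finsert y X) \<phi>)"
proof (rule sat_BoxI[OF w \<nu>])
  show "\<nu> ` fset (finsert y X) \<subseteq> dmn M w" using y box by simp
  fix u \<mu>
  assume "(w, u) \<in> acc M" "\<And>x. x \<in> fset (finsert y X) \<Longrightarrow> \<mu> x = \<nu> x"
    "\<mu> ` (FV \<phi> \<union> fset (finsert y X)) \<subseteq> dmn M u"
  then show "sat M \<mu> u \<phi>" by (intro sat_BoxD[OF box]) auto
qed

lemma sat_Box_refl:
  assumes "w \<in> wld M" "\<nu> ` FV \<phi> \<subseteq> dmn M w" "sat M \<nu> w (Box X \<phi>)"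
  shows "sat M \<nu> w \<phi>"
proof (rule sat_BoxD[OF assms(3)])
  show "(w, w) \<in> acc M" using acc_refl assms(1) by (auto dest: refl_onD)
qed (use assms(2) in auto)

lemma sat_Box_mp:
  assumes w: "w \<in> wld M" and \<nu>: "range \<nu> \<subseteq> full_dmn M"
    and imp: "sat M \<nu> w (Box X (Imp \<phi> \<psi>))" and \<phi>: "sat M \<nu> w (Box X \<phi>)"
  shows "sat M \<nu> w (Box X \<psi>)"
proof (rule sat_BoxI[OF w \<nu>])
  show "\<nu> ` fset X \<subseteq> dmn M w" using \<phi> by simp
  fix u \<mu>
  assume u: "(w, u) \<in> acc M" and agree: "\<And>x. x \<in> fset X \<Longrightarrow> \<mu> x = \<nu> x"
    and \<mu>: "\<mu> ` (FV \<psi> \<union> fset X) \<subseteq> dmn M u"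
  \<comment> \<open>Variables of \<open>\<phi>\<close> outside \<open>X\<close> and not free in
    \<open>\<psi>\<close> may have values under \<open>\<mu>\<close> that do not exist at
    \<open>u\<close>. They are sent to \<open>a\<close>, which affects neither \<open>\<psi>\<close>
    nor the values on \<open>X\<close>.\<close>
  obtain a where a: "a \<in> dmn M u" using dmn_nonempty acc_world[OF u] by blast
  define \<mu>' where "\<mu>' = override_on (\<lambda>_. a) \<mu> (FV \<psi> \<union> fset X)"
  have dom: "\<mu>' x \<in> dmn M u" for x
    using a \<mu> by (auto simp: \<mu>'_def override_on_def)
  have agree': "\<mu>' x = \<nu> x" if "x \<in> fset X" for x
    using that agree by (simp add: \<mu>'_def override_on_def)
  have "sat M \<mu>' u (Imp \<phi> \<psi>)" "sat M \<mu>' u \<phi>"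
    by (rule sat_BoxD[OF imp u agree'] sat_BoxD[OF \<phi> u agree']; use dom in auto)+
  then have "sat M \<mu>' u \<psi>" by (auto simp: image_Un)
  moreover have "sat M \<mu>' u \<psi> = sat M \<mu> u \<psi>"
    by (rule sat_cong) (simp add: \<mu>'_def override_on_def)
  ultimately show "sat M \<mu> u \<psi>" by simp
qed

text \<open>By transitivity every world reached from \<open>u\<close> is reached from
  \<open>w\<close>. Both introspection axioms use this, with \<open>\<mu>\<close> arising from the
  outer modality.\<close>

lemma sat_Box_acc:
  assumes u: "(w, u) \<in> acc M" and \<mu>: "range \<mu> \<subseteq> full_dmn M"
    and agree: "\<And>x. x \<in> fset X \<Longrightarrow> \<mu> x = \<nu> x" and box: "sat M \<nu> w (Box X \<phi>)"
  shows "sat M \<mu> u (Box X \<phi>)"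
proof (rule sat_BoxI[OF _ \<mu>])
  show "u \<in> wld M" using acc_world[OF u] by blast
  show "\<mu> ` fset X \<subseteq> dmn M u" using box agree dmn_mono[OF u] by auto
  fix v \<kappa>
  assume "(u, v) \<in> acc M" "\<And>x. x \<in> fset X \<Longrightarrow> \<kappa> x = \<mu> x" "\<kappa> ` (FV \<phi> \<union> fset X) \<subseteq> dmn M v"
  then show "sat M \<kappa> v \<phi>"
    using agree transD[OF acc_trans u] by (intro sat_BoxD[OF box]) auto
qed

lemma sat_Box_Box:
  assumes "w \<in> wld M" "range \<nu> \<subseteq> full_dmn M" "sat M \<nu> w (Box X \<phi>)"
  shows "sat M \<nu> w (Box X (Box X \<phi>))"
proof (rule sat_BoxI[OF assms(1,2)])
  show "\<nu> ` fset X \<subseteq> dmn M w" using assms(3) by simp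
qed (rule sat_Box_acc[OF _ _ _ assms(3)])

text \<open>Since \<open>x\<close> is outside the index set, a free \<open>x\<close> already ranges
  over the whole domain of \<open>u\<close> under the modality, which is what the quantifier
  asks.\<close>

lemma sat_Box_Forall:
  assumes w: "w \<in> wld M" and \<nu>: "range \<nu> \<subseteq> full_dmn M" and x: "x |\<notin>| X"
    and box: "sat M \<nu> w (Box X \<phi>)"
  shows "sat M \<nu> w (Box X (Forall x \<phi>))"
proof (rule sat_BoxI[OF w \<nu>])
  show "\<nu> ` fset X \<subseteq> dmn M w" using box by simp
  fix u \<mu>
  assume u: "(w, u) \<in> acc M" and agree: "\<And>x. x \<in> fset X \<Longrightarrow> \<mu> x = \<nu> x"
    and \<mu>: "\<mu> ` (FV (Forall x \<phi>) \<union> fset X) \<subseteq> dmn M u"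
  have "sat M (\<mu>(x := a)) u \<phi>" if "a \<in> dmn M u" for a
    by (rule sat_BoxD[OF box u]) (use agree \<mu> x that in auto)
  then show "sat M \<mu> u (Forall x \<phi>)" by simp
qed

section \<open>Axioms for justification terms\<close>

lemma evd_extend:
  assumes "range \<nu> \<subseteq> full_dmn M" "finite Z" "Y \<subseteq> Z" "\<nu> ` Z \<subseteq> dmn M w"
    and "w \<in> evd M t \<phi> ((Some \<circ> \<nu>) |` Y)"
  shows "w \<in> evd M t \<phi> ((Some \<circ> \<nu>) |` Z)"
proof (rule extension[OF _ assms(5)])
  show "(Some \<circ> \<nu>) |` Y \<in> finval M"
    using assms(1-3) restricted_valuation_finval finite_subset by blast
qed (rule restricted_valuation_ext[OF assms(3,2,4)])

lemma sat_Just_App: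
  assumes w: "w \<in> wld M" and \<nu>: "range \<nu> \<subseteq> full_dmn M"
    and imp: "sat M \<nu> w (Just t X (Imp \<phi> \<psi>))" and \<phi>: "sat M \<nu> w (Just s X \<phi>)"
  shows "sat M \<nu> w (Just (App t s) X \<psi>)"
proof -
  let ?Y = "FV (Imp \<phi> \<psi>) \<inter> fset X"
  let ?f = "(Some \<circ> \<nu>) |` ?Y"
  have f: "?f \<in> finval M" by (rule restricted_valuation_finval[OF \<nu>]) simp
  have "w \<in> evd M s \<phi> ((Some \<circ> \<nu>) |` (FV \<phi> \<inter> fset X))" using \<phi> unfolding sat_Just_iff by blast
  then have "w \<in> evd M s \<phi> ?f"
    by (rule evd_extend[OF \<nu>, rotated 3]) (use \<phi> in auto)
  moreover have "w \<in> evd M t (Imp \<phi> \<psi>) ?f" using imp unfolding sat_Just_iff by blast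
  ultimately have "w \<in> evd M (App t s) \<psi> ?f" using evd_App[OF f] by blast
  then have "w \<in> evd M (App t s) \<psi> (?f |` FV \<psi>)" using restriction[OF f] by blast
  moreover have "?f |` FV \<psi> = (Some \<circ> \<nu>) |` (FV \<psi> \<inter> fset X)"
    by (auto simp: restrict_map_def fun_eq_iff)
  ultimately show ?thesis
    using sat_Box_mp[OF w \<nu>, of X \<phi> \<psi>] imp \<phi> by (simp add: sat_Just_iff del: sat.simps)
qed

text \<open>At accessible worlds the modal part of the inner formula persists by transitivity and
  its evidence by \<open>R_closure\<close>. Evidence for \<open>Bang t\<close> comes from
  \<open>evd_Bang\<close> with the valuation on all of \<open>X\<close>, because the free variables
  of \<open>Just t X \<phi>\<close> are exactly \<open>X\<close>.\<close>

lemma sat_Just_Bang: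
  assumes w: "w \<in> wld M" and \<nu>: "range \<nu> \<subseteq> full_dmn M" and just: "sat M \<nu> w (Just t X \<phi>)"
  shows "sat M \<nu> w (Just (Bang t) X (Just t X \<phi>))"
proof -
  let ?f = "(Some \<circ> \<nu>) |` (FV \<phi> \<inter> fset X)"
  have box: "sat M \<nu> w (Box X \<phi>)" and evd: "w \<in> evd M t \<phi> ?f"
    using just unfolding sat_Just_iff by blast+
  have f: "?f \<in> finval M" by (rule restricted_valuation_finval[OF \<nu>]) simp
  have "sat M \<nu> w (Box X (Just t X \<phi>))"
  proof (rule sat_BoxI[OF w \<nu>])
    show "\<nu> ` fset X \<subseteq> dmn M w" using just by simp
    fix u \<mu>
    assume u: "(w, u) \<in> acc M" and \<mu>: "range \<mu> \<subseteq> full_dmn M"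
      and agree: "\<And>x. x \<in> fset X \<Longrightarrow> \<mu> x = \<nu> x"
    \<comment> \<open>Reassignment leaves \<open>X\<close> alone, so the evidence condition at
      \<open>u\<close> concerns the same finite valuation.\<close>
    have "(Some \<circ> \<mu>) |` (FV \<phi> \<inter> fset X) = ?f"
      using agree by (auto simp: restrict_map_def fun_eq_iff)
    then show "sat M \<mu> u (Just t X \<phi>)"
      using R_closure[OF f u evd] sat_Box_acc[OF u \<mu> agree box]
      by (simp add: sat_Just_iff del: sat.simps)
  qed
  moreover have "w \<in> evd M (Bang t) (Just t X \<phi>) ((Some \<circ> \<nu>) |` fset X)"
  proof (rule evd_Bang[OF f evd])
    show "(Some \<circ> \<nu>) |` fset X \<in> ext ?f (dmn M w)"
      by (rule restricted_valuation_ext) (use just in auto)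
  qed (auto simp: dom_def restrict_map_def)
  ultimately show ?thesis by (simp add: sat_Just_iff del: sat.simps)
qed

section \<open>Validity of all axioms\<close>

lemma axiom_sound:
  assumes "axiom \<phi>" and w: "w \<in> wld M" and \<nu>: "range \<nu> \<subseteq> full_dmn M"
    and dom: "\<nu> ` FV \<phi> \<subseteq> dmn M w"
  shows "sat M \<nu> w \<phi>"
proof -
  have imp_holds: "sat M \<nu> w \<phi>"
    if "\<phi> = Imp \<psi> \<chi>" "sat M \<nu> w \<psi> \<Longrightarrow> sat M \<nu> w \<chi>" for \<psi> \<chi>
    using that dom sat_Imp_iff by blast
  \<comment> \<open>For the two application axioms: the domain guard of the outer implication
    supplies that of the inner one.\<close>
  have imp_imp_holds: "sat M \<nu> w \<phi>"
    if "\<phi> = Imp \<psi> (Imp \<chi> \<theta>)" "sat M \<nu> w \<psi> \<Longrightarrow> sat M \<nu> w \<chi> \<Longrightarrow> sat M \<nu> w \<theta>" for \<psi> \<chi> \<theta>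
    using that dom sat_Imp_iff[of \<nu> \<psi> "Imp \<chi> \<theta>"] sat_Imp_iff[of \<nu> \<chi> \<theta>] by auto
  have fin: "(Some \<circ> \<nu>) |` (Y \<inter> fset X) \<in> finval M" for Y X
    by (rule restricted_valuation_finval[OF \<nu>]) simp
  from assms(1) show ?thesis
  proof cases
    case A0
    then show ?thesis using axiom0_sound w \<nu> dom by blast
  next
    case (A1 y \<psi> t X)
    \<comment> \<open>The evidence clause thus refers to the same restriction of
      \<open>\<nu>\<close> before and after \<open>y\<close> is removed.\<close>
    then have "FV \<psi> \<inter> fset (finsert y X) = FV \<psi> \<inter> fset X" by auto
    then show ?thesis
      using sat_Box_remove[OF A1(2)]
      by (intro imp_holds[OF A1(1)]) (simp add: sat_Just_iff del: sat.simps)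
  next
    case (A1' y \<psi> X)
    show ?thesis by (rule imp_holds[OF A1'(1) sat_Box_remove[OF A1'(2)]])
  next
    case (A2 t X \<psi> y)
    \<comment> \<open>\<open>y\<close> is free in the consequent, so its value exists at
      \<open>w\<close>; both the extension of evidence and \<open>sat_Box_insert\<close> rely on
      this.\<close>
    have dom': "\<nu> ` fset (finsert y X) \<subseteq> dmn M w" using dom A2 by auto
    have "w \<in> evd M t \<psi> ((Some \<circ> \<nu>) |` (FV \<psi> \<inter> fset (finsert y X)))"
      if "w \<in> evd M t \<psi> ((Some \<circ> \<nu>) |` (FV \<psi> \<inter> fset X))"
      by (rule evd_extend[OF \<nu> _ _ _ that]) (use dom' in auto)
    then show ?thesis
      using sat_Box_insert[OF w \<nu>, of y X \<psi>] dom'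
      by (intro imp_holds[OF A2]) (simp add: sat_Just_iff del: sat.simps)
  next
    case (A2' X \<psi> y)
    then have "\<nu> y \<in> dmn M w" using dom by auto
    then show ?thesis by (rule imp_holds[OF A2' sat_Box_insert[OF w \<nu>]])
  next
    case (A3 t X \<psi>)
    then have "\<nu> ` FV \<psi> \<subseteq> dmn M w" using dom by auto
    then show ?thesis using sat_Box_refl[OF w]
      by (intro imp_holds[OF A3]) (auto simp: sat_Just_iff simp del: sat.simps)
  next
    case (A3' X \<psi>)
    then have "\<nu> ` FV \<psi> \<subseteq> dmn M w" using dom by auto
    then show ?thesis by (rule imp_holds[OF A3' sat_Box_refl[OF w]])
  next
    case A4
    show ?thesis by (rule imp_imp_holds[OF A4 sat_Just_App[OF w \<nu>]])
  next
    case A4'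
    show ?thesis by (rule imp_imp_holds[OF A4' sat_Box_mp[OF w \<nu>]])
  next
    case (A5_left t X \<psi> s)
    show ?thesis using evd_Plus[OF fin, of t \<psi> "FV \<psi>" X s]
      by (intro imp_holds[OF A5_left]) (auto simp: sat_Just_iff simp del: sat.simps)
  next
    case (A5_right s X \<psi> t)
    show ?thesis using evd_Plus[OF fin, of t \<psi> "FV \<psi>" X s]
      by (intro imp_holds[OF A5_right]) (auto simp: sat_Just_iff simp del: sat.simps)
  next
    case A6
    show ?thesis by (rule imp_holds[OF A6 sat_Just_Bang[OF w \<nu>]])
  next
    case A6'
    show ?thesis by (rule imp_holds[OF A6' sat_Box_Box[OF w \<nu>]])
  next
    case (A7 x X t \<psi>)
    \<comment> \<open>Since \<open>x\<close> is not in \<open>X\<close>, it is absent from the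
      evidence valuation: quantifying over it changes no restriction, and the side condition of
      \<open>evd_Gen\<close> is met.\<close>
    have eq: "FV (Forall x \<psi>) \<inter> fset X = FV \<psi> \<inter> fset X" using A7(2) by auto
    have "x \<notin> dom ((Some \<circ> \<nu>) |` (FV \<psi> \<inter> fset X)) \<inter> FV \<psi>" using A7(2) by auto
    from evd_Gen[OF fin this] have "evd M t \<psi> ((Some \<circ> \<nu>) |` (FV \<psi> \<inter> fset X)) \<subseteq>
        evd M (Gen x t) (Forall x \<psi>) ((Some \<circ> \<nu>) |` (FV (Forall x \<psi>) \<inter> fset X))"
      unfolding eq .
    then show ?thesis
      using sat_Box_Forall[OF w \<nu> A7(2)]
      by (intro imp_holds[OF A7(1)]) (auto simp: sat_Just_iff simp del: sat.simps FV.simps)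
  next
    case A7'
    show ?thesis by (rule imp_holds[OF A7'(1) sat_Box_Forall[OF w \<nu> A7'(2)]])
  next
    case (A8 t X \<psi>)
    show ?thesis by (intro imp_holds[OF A8]) (auto simp: sat_Just_iff simp del: sat.simps)
  qed
qed

section \<open>Necessitation and derivations\<close>

text \<open>With empty index set every free variable of the axiom is reassigned within the domain of
  the accessible world, so \<open>axiom_sound\<close> applies there whatever \<open>\<nu>\<close>
  does at \<open>w\<close>.\<close>

lemma necessitation_sound:
  assumes "axiom \<phi>" "w \<in> wld M" "range \<nu> \<subseteq> full_dmn M"
  shows "sat M \<nu> w (Box {||} \<phi>)"
  by (rule sat_BoxI[OF assms(2,3)]) (use axiom_sound[OF assms(1)] acc_world in auto)

text \<open>The valuation varies in the induction, since generalization updates it and modus ponens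
  reassigns it. The world can stay fixed because necessitation applies to axioms only, and these
  hold at every world independently of \<Gamma>.\<close>

lemma derives_sound:
  assumes "derives CS \<Gamma> \<phi>" "constant_spec CS" "meets M CS" "w \<in> wld M"
    and "range \<nu> \<subseteq> full_dmn M" "\<And>\<psi>. \<psi> \<in> \<Gamma> \<Longrightarrow> sat M \<nu> w \<psi>" "\<nu> ` FV \<phi> \<subseteq> dmn M w"
  shows "sat M \<nu> w \<phi>"
  using assms(1,5-)
proof (induction arbitrary: \<nu>)
  case (hyp \<phi>)
  then show ?case by blast
next
  case (ax \<phi>)
  then show ?case using axiom_sound assms(4) by blast
next
  case (cs \<phi>)
  then obtain c \<psi> where \<phi>: "\<phi> = Just (JConst c) {||} \<psi>" and "axiom \<psi>"
    using assms(2) by (auto simp: constant_spec_def)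
  \<comment> \<open>The modal half of a member of \<open>CS\<close> is necessitation for an axiom;
    the evidence half is \<open>meets M CS\<close> at the empty valuation.\<close>
  then have "sat M \<nu> w (Box {||} \<psi>)" using necessitation_sound assms(4) cs.prems(1) by blast
  moreover have "w \<in> evd M (JConst c) \<psi> Map.empty"
    using assms(3,4) cs.hyps \<phi> by (auto simp: meets_def)
  ultimately show ?case unfolding \<phi> sat_Just_iff by simp
next
  case (mp \<phi> \<psi>)
  \<comment> \<open>The cut formula may have free variables that \<open>\<nu>\<close> sends outside \<^term>\<open>dmn M w\<close>; they occur
    neither in the conclusion nor in \<open>\<Gamma>\<close>, so they can be reassigned.\<close>
  obtain a where a: "a \<in> dmn M w" using dmn_nonempty assms(4) by blast
  define \<mu> where "\<mu> = override_on (\<lambda>_. a) \<nu> (FV \<psi> \<union> (\<Union>\<theta>\<in>\<Gamma>. FV \<theta>))"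
  \<comment> \<open>Truth of \<Gamma> at \<open>w\<close> forces its free variables to exist there,
    so \<open>\<mu>\<close> has all its values in \<open>dmn M w\<close>.\<close>
  have "\<nu> x \<in> dmn M w" if "x \<in> FV \<theta>" "\<theta> \<in> \<Gamma>" for x \<theta>
    using sat_FV_dmn[OF assms(4) mp.prems(2)] that by blast
  then have dom: "\<mu> x \<in> dmn M w" for x
    using a mp.prems(3) by (auto simp: \<mu>_def override_on_def)
  then have \<mu>: "range \<mu> \<subseteq> full_dmn M" using dmn_full[OF assms(4)] by blast
  have \<Gamma>: "sat M \<mu> w \<theta>" if "\<theta> \<in> \<Gamma>" for \<theta>
  proof -
    have "sat M \<mu> w \<theta> = sat M \<nu> w \<theta>"
      by (rule sat_cong) (use that in \<open>auto simp: \<mu>_def override_on_def\<close>)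
    with mp.prems(2)[OF that] show ?thesis by simp
  qed
  have "sat M \<mu> w (Imp \<phi> \<psi>)" "sat M \<mu> w \<phi>"
    by (rule mp.IH[OF \<mu> \<Gamma>]; use dom in auto)+
  then have "sat M \<mu> w \<psi>" by (auto simp: image_Un)
  moreover have "sat M \<mu> w \<psi> = sat M \<nu> w \<psi>"
    by (rule sat_cong) (auto simp: \<mu>_def override_on_def)
  ultimately show ?case by simp
next
  case (gen \<phi> x)
  have "sat M (\<nu>(x := a)) w \<phi>" if a: "a \<in> dmn M w" for a
  proof (rule gen.IH)
    show "range (\<nu>(x := a)) \<subseteq> full_dmn M"
      using gen.prems(1) a dmn_full[OF assms(4)] by auto
    show "(\<nu>(x := a)) ` FV \<phi> \<subseteq> dmn M w" using gen.prems(3) a by auto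
    fix \<theta> assume \<theta>: "\<theta> \<in> \<Gamma>"
    have "sat M (\<nu>(x := a)) w \<theta> = sat M \<nu> w \<theta>"
      by (rule sat_cong) (use gen.hyps(2) \<theta> in auto)
    with gen.prems(2)[OF \<theta>] show "sat M (\<nu>(x := a)) w \<theta>" by simp
  qed
  then show ?case by simp
next
  case (nec \<phi>)
  then show ?case using necessitation_sound assms(4) by blast
qed

end

theorem mainTheorem1:
  fixes CS \<Gamma> :: "form set" and \<Phi> :: form
    and M :: "('w, 'd) fmodel" and \<nu> :: "var \<Rightarrow> 'd" and w :: 'w
  assumes "constant_spec CS"
    and "derives CS \<Gamma> \<Phi>"
    and "fitting_model M"
    and "meets M CS"
    and "range \<nu> \<subseteq> full_dmn M"
    and "w \<in> wld M"
    and "\<And>\<Psi>. \<Psi> \<in> \<Gamma> \<Longrightarrow> sat M \<nu> w \<Psi>"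
    and "\<nu> ` FV \<Phi> \<subseteq> dmn M w"
  shows "sat M \<nu> w \<Phi>"
  using fitting_model.derives_sound[OF assms(3,2,1,4,6,5,7,8)] .

end
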